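(* Suppose $D\equiv 0,1\pmod 4$ and $D<0$. Put $n:=|D|$ if $D$ is odd and $n:=|D|/4$ if $D$ is even. Then $$H(|D|)=2\sum_{\substack{e>f>g>0\\ ef+eg+fg=n}}1+\sum_{\substack{e,f>0,\ e\ne f\\ e^2+2ef=n}}1+\frac13\sum_{\substack{e>0\\ 3e^2=n}}1+\frac12\sum_{\substack{e,f>0\\ ef=n}}1,$$ where the summation variables are integers (no gcd condition); in the first two sums the pairs or triples are required to be all odd if $D$ is odd; and the last sum is included only when $D$ is even.
   Context: A binary quadratic form is $[a,b,c]=ax^2+bxy+cy^2$ with $a,b,c\in\mathbb{Z}$, discriminant $b^2-4ac$. For $M=\begin{pmatrix}\alpha&\beta\\\gamma&\delta\end{pmatrix}$ put $q|M(x,y)=q(\alpha x+\beta y,\gamma x+\delta y)$; forms $q_1,q_2$ are equivalent if $q_1=q_2|M$ for some $M\in\mathrm{SL}(2,\mathbb{Z})$. For $D<0$ the Hurwitz class number $H(|D|)$ is the number of equivalence classes of (not necessarily primitive) forms of discriminant $D$ with $a,c>0$, where, for each integer $a\ge1$, the class of $[a,a,a]$ is counted with weight $1/3$ and the class of $[a,0,a]$ with weight $1/2$ (all other classes with weight $1$). *)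

theory Defs
  imports "HOL-Analysis.Determinants"
begin

datatype bqf = BQF (coeff_a: int) (coeff_b: int) (coeff_c: int)

definition bqf_eval :: "bqf \<Rightarrow> int \<Rightarrow> int \<Rightarrow> int" where
  "bqf_eval q x y = coeff_a q * x^2 + coeff_b q * x * y + coeff_c q * y^2"

definition bqf_disc :: "bqf \<Rightarrow> int" where
  "bqf_disc q = (coeff_b q)^2 - 4 * coeff_a q * coeff_c q"

text \<open>The form $q|M$, given by its coefficients; these are forced by the substitution
  rule, see \<open>bqf_eval_act\<close> and \<open>bqf_eqI\<close> below.\<close>

definition bqf_act :: "bqf \<Rightarrow> int^2^2 \<Rightarrow> bqf" where
  "bqf_act q M =
    (let \<alpha> = M $ 1 $ 1; \<beta> = M $ 1 $ 2; \<gamma> = M $ 2 $ 1; \<delta> = M $ 2 $ 2 in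
      BQF (coeff_a q * \<alpha>^2 + coeff_b q * \<alpha> * \<gamma> + coeff_c q * \<gamma>^2)
          (2 * coeff_a q * \<alpha> * \<beta> + coeff_b q * (\<alpha> * \<delta> + \<beta> * \<gamma>) + 2 * coeff_c q * \<gamma> * \<delta>)
          (coeff_a q * \<beta>^2 + coeff_b q * \<beta> * \<delta> + coeff_c q * \<delta>^2))"

lemma bqf_eval_act:
  "bqf_eval (bqf_act q M) x y =
     bqf_eval q (M $ 1 $ 1 * x + M $ 1 $ 2 * y) (M $ 2 $ 1 * x + M $ 2 $ 2 * y)"
  by (simp add: bqf_eval_def bqf_act_def Let_def power2_eq_square algebra_simps)

lemma bqf_eqI:
  assumes "\<And>x y. bqf_eval q x y = bqf_eval q' x y"
  shows "q = q'"
  using assms[of 1 0] assms[of 0 1] assms[of 1 1]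
  by (auto intro: bqf.expand simp: bqf_eval_def)

definition SL2Z :: "(int^2^2) set" where
  "SL2Z = {M. det M = 1}"

definition bqf_equiv :: "(bqf \<times> bqf) set" where
  "bqf_equiv = {(q1, q2). \<exists>M\<in>SL2Z. q1 = bqf_act q2 M}"

lemma equiv_bqf_equiv: "equiv UNIV bqf_equiv"
proof (rule equivI)
  show "bqf_equiv \<subseteq> UNIV \<times> UNIV" by simp
  show "refl bqf_equiv"
  proof (rule refl_onI)
    fix q
    have "q = bqf_act q (mat 1)"
      by (rule bqf_eqI) (simp add: bqf_eval_act mat_def)
    then show "(q, q) \<in> bqf_equiv"
      unfolding bqf_equiv_def SL2Z_def using det_I by blast
  qed
  show "sym bqf_equiv"
  proof (rule symI)
    fix q1 q2 assume "(q1, q2) \<in> bqf_equiv"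
    then obtain M :: "int^2^2" where M: "det M = 1" "q1 = bqf_act q2 M"
      by (auto simp: bqf_equiv_def SL2Z_def)
    define N :: "int^2^2" where
      "N = vector [vector [M $ 2 $ 2, - (M $ 1 $ 2)], vector [- (M $ 2 $ 1), M $ 1 $ 1]]"
    have N: "N $ 1 $ 1 = M $ 2 $ 2" "N $ 1 $ 2 = - (M $ 1 $ 2)"
        "N $ 2 $ 1 = - (M $ 2 $ 1)" "N $ 2 $ 2 = M $ 1 $ 1"
      by (simp_all add: N_def)
    have d: "M $ 1 $ 1 * M $ 2 $ 2 - M $ 1 $ 2 * M $ 2 $ 1 = 1"
      using M(1) by (simp add: det_2)
    have x: "M $ 1 $ 1 * (M $ 2 $ 2 * x - M $ 1 $ 2 * y)
        + M $ 1 $ 2 * (M $ 1 $ 1 * y - M $ 2 $ 1 * x) = x" for x y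
      using d by algebra
    have y: "M $ 2 $ 1 * (M $ 2 $ 2 * x - M $ 1 $ 2 * y)
        + M $ 2 $ 2 * (M $ 1 $ 1 * y - M $ 2 $ 1 * x) = y" for x y
      using d by algebra
    have "q2 = bqf_act q1 N"
      by (rule bqf_eqI) (simp add: M(2) bqf_eval_act N x y)
    moreover have "det N = 1"
      using d by (simp add: det_2 N algebra_simps)
    ultimately show "(q2, q1) \<in> bqf_equiv"
      by (auto simp: bqf_equiv_def SL2Z_def)
  qed
  show "trans bqf_equiv"
  proof (rule transI)
    fix q1 q2 q3 assume "(q1, q2) \<in> bqf_equiv" "(q2, q3) \<in> bqf_equiv"
    then obtain M N :: "int^2^2" where MN: "det M = 1" "q1 = bqf_act q2 M"
        "det N = 1" "q2 = bqf_act q3 N"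
      by (auto simp: bqf_equiv_def SL2Z_def)
    have "q1 = bqf_act q3 (N ** M)"
      by (rule bqf_eqI)
        (simp add: MN bqf_eval_act matrix_matrix_mult_def sum_2 algebra_simps)
    moreover have "det (N ** M) = 1"
      by (simp add: det_mul MN)
    ultimately show "(q1, q3) \<in> bqf_equiv"
      unfolding bqf_equiv_def SL2Z_def by blast
  qed
qed

definition positive_bqfs :: "int \<Rightarrow> bqf set" where
  "positive_bqfs D = {q. bqf_disc q = D \<and> coeff_a q > 0 \<and> coeff_c q > 0}"

definition class_weight :: "bqf set \<Rightarrow> rat" where
  "class_weight C =
    (if \<exists>a\<ge>1. C = bqf_equiv `` {BQF a a a} then 1/3
     else if \<exists>a\<ge>1. C = bqf_equiv `` {BQF a 0 a} then 1/2
     else 1)"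

text \<open>The argument is \<open>N = \<bar>D\<bar>\<close>, so the forms counted have discriminant \<open>- N\<close>. Only
  \<open>N > 0\<close> is meaningful; the set of classes is then finite.\<close>

definition hurwitz_class_number :: "int \<Rightarrow> rat" where
  "hurwitz_class_number N = (\<Sum>C \<in> positive_bqfs (- N) // bqf_equiv. class_weight C)"

end

theory Submission
  imports Defs
begin

text \<open>Every positive definite class contains exactly one reduced form, i.e. one with
  $-a < b \le a \le c$, and $b \ge 0$ if $a = c$. With Selling's parameters
  $e \ge f \ge g \ge 0$, a form is
  $f x^2 + e y^2 + g (x + y)^2 = [f + g, 2g, e + g]$
  of discriminant $-4 (ef + eg + fg)$; for odd $D$ the coefficients are halved and $e, f, g$ odd. So a
  triple describes a reduced form with $b \ge 0$, and the opposite form $[a, -b, c]$ is a second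
  reduced form exactly when $e > f > g > 0$. The four sums of the formula sort the
  triples by the coincidences among $e$, $f$, $g$, $0$.\<close>

section \<open>Equivalence in integer coordinates\<close>

lemma bqf_equiv_iff:
  "(q1, q2) \<in> bqf_equiv \<longleftrightarrow> (\<exists>\<alpha> \<beta> \<gamma> \<delta>. \<alpha> * \<delta> - \<beta> * \<gamma> = 1 \<and>
     coeff_a q1 = coeff_a q2 * \<alpha>^2 + coeff_b q2 * \<alpha> * \<gamma> + coeff_c q2 * \<gamma>^2 \<and>
     coeff_b q1 = 2 * coeff_a q2 * \<alpha> * \<beta> + coeff_b q2 * (\<alpha> * \<delta> + \<beta> * \<gamma>) + 2 * coeff_c q2 * \<gamma> * \<delta> \<and>
     coeff_c q1 = coeff_a q2 * \<beta>^2 + coeff_b q2 * \<beta> * \<delta> + coeff_c q2 * \<delta>^2)"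
  (is "?L \<longleftrightarrow> ?R")
proof
  assume ?L
  then obtain M where "det M = 1" "q1 = bqf_act q2 M"
    by (auto simp: bqf_equiv_def SL2Z_def)
  then show ?R
    by (intro exI[of _ "M$1$1"] exI[of _ "M$1$2"] exI[of _ "M$2$1"] exI[of _ "M$2$2"])
      (simp add: det_2 bqf_act_def Let_def)
next
  assume ?R
  then obtain \<alpha> \<beta> \<gamma> \<delta> where h: "\<alpha> * \<delta> - \<beta> * \<gamma> = 1"
     "coeff_a q1 = coeff_a q2 * \<alpha>^2 + coeff_b q2 * \<alpha> * \<gamma> + coeff_c q2 * \<gamma>^2"
     "coeff_b q1 = 2 * coeff_a q2 * \<alpha> * \<beta> + coeff_b q2 * (\<alpha> * \<delta> + \<beta> * \<gamma>) + 2 * coeff_c q2 * \<gamma> * \<delta>"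
     "coeff_c q1 = coeff_a q2 * \<beta>^2 + coeff_b q2 * \<beta> * \<delta> + coeff_c q2 * \<delta>^2"
    by blast
  define M :: "int^2^2" where "M = vector [vector [\<alpha>, \<beta>], vector [\<gamma>, \<delta>]]"
  have "det M = 1" "q1 = bqf_act q2 M"
    using h by (auto simp: M_def det_2 bqf_act_def Let_def intro: bqf.expand)
  then show ?L
    by (auto simp: bqf_equiv_def SL2Z_def)
qed

text \<open>A substitution multiplies the discriminant by the square of its determinant.\<close>

lemma bqf_disc_equiv:
  assumes "(q1, q2) \<in> bqf_equiv"
  shows "bqf_disc q1 = bqf_disc q2"
proof -
  obtain \<alpha> \<beta> \<gamma> \<delta> where h: "\<alpha> * \<delta> - \<beta> * \<gamma> = 1"
     "coeff_a q1 = coeff_a q2 * \<alpha>^2 + coeff_b q2 * \<alpha> * \<gamma> + coeff_c q2 * \<gamma>^2"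
     "coeff_b q1 = 2 * coeff_a q2 * \<alpha> * \<beta> + coeff_b q2 * (\<alpha> * \<delta> + \<beta> * \<gamma>) + 2 * coeff_c q2 * \<gamma> * \<delta>"
     "coeff_c q1 = coeff_a q2 * \<beta>^2 + coeff_b q2 * \<beta> * \<delta> + coeff_c q2 * \<delta>^2"
    using assms unfolding bqf_equiv_iff by blast
  have "bqf_disc q1 = (\<alpha> * \<delta> - \<beta> * \<gamma>)^2 * bqf_disc q2"
    unfolding bqf_disc_def h(2-4) by algebra
  then show ?thesis using h(1) by simp
qed

section \<open>Existence of a reduced form in every class\<close>

text \<open>The last conjunct treats both boundaries at once: it excludes \<open>b = -a\<close>, and
  it chooses the sign of \<open>b\<close> when \<open>a = c\<close>.\<close>

definition reduced :: "bqf \<Rightarrow> bool" where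
  "reduced q \<longleftrightarrow> 0 < coeff_a q \<and> \<bar>coeff_b q\<bar> \<le> coeff_a q \<and> coeff_a q \<le> coeff_c q \<and>
     (\<bar>coeff_b q\<bar> = coeff_a q \<or> coeff_a q = coeff_c q \<longrightarrow> 0 \<le> coeff_b q)"

lemma coeff_c_pos:
  assumes "bqf_disc q < 0" "coeff_a q > 0"
  shows "coeff_c q > 0"
proof (rule ccontr)
  assume "\<not> ?thesis"
  then have "coeff_a q * coeff_c q \<le> 0"
    using assms by (simp add: mult_nonneg_nonpos)
  then show False
    using assms(1) zero_le_power2[of "coeff_b q"] unfolding bqf_disc_def by linarith
qed

text \<open>The substitution \<open>(x, y) -> (-y, x)\<close>. With the translations
  \<open>(x, y) -> (x + k y, y)\<close> of \<open>shift_equiv\<close>, these are the only moves that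
  the reduction makes.\<close>

lemma swap_equiv: "(BQF c (-b) a, BQF a b c) \<in> bqf_equiv"
  unfolding bqf_equiv_iff
  by (rule exI[of _ 0], rule exI[of _ "-1"], rule exI[of _ 1], rule exI[of _ 0]) simp

lemma shift_equiv: "(BQF a (b + 2 * a * k) (a * k^2 + b * k + c), BQF a b c) \<in> bqf_equiv"
  unfolding bqf_equiv_iff
  by (rule exI[of _ 1], rule exI[of _ k], rule exI[of _ 0], rule exI[of _ 1]) simp

lemma bqf_equiv_trans: "(p, q) \<in> bqf_equiv \<Longrightarrow> (q, r) \<in> bqf_equiv \<Longrightarrow> (p, r) \<in> bqf_equiv"
  using equiv_bqf_equiv by (meson equivE transD)

lemma bqf_equiv_sym: "(p, q) \<in> bqf_equiv \<Longrightarrow> (q, p) \<in> bqf_equiv"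
  using equiv_bqf_equiv by (meson equivE symD)

lemma bqf_equiv_refl: "(p, p) \<in> bqf_equiv"
  using equiv_bqf_equiv by (meson equivE refl_onD UNIV_I)

lemma ex_centered_residue:
  fixes a b :: int
  assumes "a > 0"
  obtains k where "- a < b + 2 * a * k" "b + 2 * a * k \<le> a"
proof -
  \<comment> \<open>Dividing \<open>a - b\<close> instead of \<open>b\<close> gives
    \<open>b + 2 a k = a - r\<close>, so the half-open interval is closed at
    \<open>a\<close>.\<close>
  define r where "r = (a - b) mod (2 * a)"
  have "0 \<le> r" "r < 2 * a" "a - b = 2 * a * ((a - b) div (2 * a)) + r"
    using assms unfolding r_def by (simp_all only: mult_div_mod_eq) auto
  then show thesis
    by (intro that[of "(a - b) div (2 * a)"]) linarith+
qed

text \<open>In the class, take a form whose positive leading coefficient is minimal and translate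
  its middle coefficient into the interval from \<open>-a\<close> to \<open>a\<close>. The swapped
  form has leading coefficient \<open>c\<close>, so minimality gives
  \<open>a \<le> c\<close>.\<close>

lemma ex_reduced:
  assumes "bqf_disc q < 0" "coeff_a q > 0"
  obtains r where "(r, q) \<in> bqf_equiv" "reduced r"
proof -
  define P where "P m \<longleftrightarrow> (\<exists>p. (p, q) \<in> bqf_equiv \<and> coeff_a p = int m \<and> m > 0)" for m
  have "P (nat (coeff_a q))"
    unfolding P_def using assms(2) bqf_equiv_refl[of q] by (intro exI[of _ q]) auto
  then have PL: "P (LEAST m. P m)" by (rule LeastI)
  obtain p where p: "(p, q) \<in> bqf_equiv" "coeff_a p = int (LEAST m. P m)" "coeff_a p > 0"
    using PL unfolding P_def by auto
  have min: "coeff_a p \<le> coeff_a p'" if p': "(p', q) \<in> bqf_equiv" "coeff_a p' > 0" for p'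
  proof -
    have "P (nat (coeff_a p'))"
      unfolding P_def using p' by (intro exI[of _ p']) auto
    then have "(LEAST m. P m) \<le> nat (coeff_a p')" by (rule Least_le)
    then show ?thesis using p(2) p'(2) by linarith
  qed
  obtain k where k: "- coeff_a p < coeff_b p + 2 * coeff_a p * k"
      "coeff_b p + 2 * coeff_a p * k \<le> coeff_a p"
    using ex_centered_residue[OF p(3)] by blast
  define a b c where "a = coeff_a p" and "b = coeff_b p + 2 * coeff_a p * k"
    and "c = coeff_a p * k^2 + coeff_b p * k + coeff_c p"
  have eq: "(BQF a b c, q) \<in> bqf_equiv"
    using shift_equiv[of "coeff_a p" "coeff_b p" k "coeff_c p"] bqf_equiv_trans[OF _ p(1)]
    by (simp add: a_def b_def c_def)
  have a: "a > 0" "- a < b" "b \<le> a"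
    using p(3) k by (simp_all add: a_def b_def)
  have c: "c > 0"
    using coeff_c_pos[of "BQF a b c"] bqf_disc_equiv[OF eq] assms(1) a(1) by simp
  have eq': "(BQF c (-b) a, q) \<in> bqf_equiv"
    using bqf_equiv_trans[OF swap_equiv eq] .
  have ac: "a \<le> c"
    using min[OF eq'] c by (simp add: a_def)
  show thesis
  \<comment> \<open>On the boundary \<open>a = c\<close> the swap only changes the sign of
    \<open>b\<close>, so it repairs a negative \<open>b\<close>.\<close>
  proof (cases "a = c \<and> b < 0")
    case True
    then show ?thesis using a c by (intro that[OF eq']) (auto simp: reduced_def)
  next
    case False
    then show ?thesis using a c ac by (intro that[OF eq]) (auto simp: reduced_def)
  qed
qed

section \<open>Uniqueness of the reduced form\<close>

text \<open>Complete the square: four times the left-hand side is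
  \<open>(2|x| - |y|)^2 + 3 y^2\<close>. The hypothesis is symmetric, so \<open>x\<close> obeys the
  same bound.\<close>

lemma small_norm_form:
  fixes x y :: int
  assumes "x^2 - \<bar>x * y\<bar> + y^2 \<le> 1"
  shows "\<bar>y\<bar> \<le> 1"
proof -
  have "3 * y^2 \<le> (2 * \<bar>x\<bar> - \<bar>y\<bar>)^2 + 3 * y^2" by simp
  also have "\<dots> = 4 * (x^2 - \<bar>x * y\<bar> + y^2)"
    by (simp add: power2_eq_square algebra_simps abs_mult)
  also have "\<dots> \<le> 4 * 1" using assms by (intro mult_left_mono) auto
  finally have "3 * y^2 \<le> 4" by simp
  then have "y^2 < 2^2" by simp
  then show ?thesis using power2_less_imp_less[of "\<bar>y\<bar>" 2] by simp
qed

lemma bqf_eqI_disc: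
  assumes "coeff_a p = coeff_a q" "coeff_b p = coeff_b q" "bqf_disc p = bqf_disc q"
    "coeff_a q \<noteq> 0"
  shows "p = q"
  using assms by (intro bqf.expand) (simp add: bqf_disc_def)

lemma int_small_multiple:
  fixes a k :: int
  assumes "\<bar>2 * a * k\<bar> < 2 * a"
  shows "k = 0"
proof (rule ccontr)
  assume "k \<noteq> 0"
  then have "1 \<le> \<bar>k\<bar>" by simp
  moreover have "0 < a" using assms by linarith
  ultimately have "2 * a * 1 \<le> 2 * a * \<bar>k\<bar>" by (intro mult_left_mono) auto
  then show False using assms \<open>0 < a\<close> by (simp add: abs_mult)
qed

text \<open>The leading coefficient of \<open>p\<close> is the value of \<open>q\<close> at the
  first column \<open>(\<alpha>, \<gamma>)\<close> of the matrix. For reduced \<open>q\<close> this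
  value is at least \<open>a (\<alpha>^2 - |\<alpha> \<gamma>| + \<gamma>^2)\<close>, so
  \<open>le\<close> leaves only entries 0, 1, -1 in that column. The assumption \<open>le\<close> is
  later removed by symmetry.\<close>

lemma reduced_unique_aux:
  assumes p: "reduced p" and q: "reduced q" and eq: "(p, q) \<in> bqf_equiv"
    and le: "coeff_a p \<le> coeff_a q"
  shows "p = q"
proof -
  obtain a b c where abc: "q = BQF a b c" by (cases q)
  obtain a' b' c' where abc': "p = BQF a' b' c'" by (cases p)
  obtain \<alpha> \<beta> \<gamma> \<delta> where h: "\<alpha> * \<delta> - \<beta> * \<gamma> = 1"
     "a' = a * \<alpha>^2 + b * \<alpha> * \<gamma> + c * \<gamma>^2"
     "b' = 2 * a * \<alpha> * \<beta> + b * (\<alpha> * \<delta> + \<beta> * \<gamma>) + 2 * c * \<gamma> * \<delta>"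
    using eq unfolding bqf_equiv_iff abc abc' by auto
  have Q: "0 < a" "\<bar>b\<bar> \<le> a" "a \<le> c" "\<bar>b\<bar> = a \<or> a = c \<Longrightarrow> 0 \<le> b"
    using q by (auto simp: reduced_def abc)
  have P: "0 < a'" "\<bar>b'\<bar> \<le> a'" "a' \<le> c'" "\<bar>b'\<bar> = a' \<or> a' = c' \<Longrightarrow> 0 \<le> b'"
    using p by (auto simp: reduced_def abc')
  have aa: "a' \<le> a" using le by (simp add: abc abc')
  have disc: "b'^2 - 4 * a' * c' = b^2 - 4 * a * c"
    using bqf_disc_equiv[OF eq] by (simp add: bqf_disc_def abc abc')
  have "\<bar>b * (\<alpha> * \<gamma>)\<bar> \<le> a * \<bar>\<alpha> * \<gamma>\<bar>"
    unfolding abs_mult[of b] using Q by (intro mult_right_mono) auto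
  moreover have "a * \<gamma>^2 \<le> c * \<gamma>^2"
    using Q by (intro mult_right_mono) auto
  ultimately have "a * (\<alpha>^2 - \<bar>\<alpha> * \<gamma>\<bar> + \<gamma>^2) \<le> a'"
    unfolding h(2) by (simp add: algebra_simps)
  then have "a * (\<alpha>^2 - \<bar>\<alpha> * \<gamma>\<bar> + \<gamma>^2) \<le> a * 1" using aa by simp
  then have le1: "\<alpha>^2 - \<bar>\<alpha> * \<gamma>\<bar> + \<gamma>^2 \<le> 1" using Q(1) by (simp only: mult_le_cancel_left_pos)
  have "\<bar>\<gamma>\<bar> \<le> 1" using small_norm_form[OF le1] .
  moreover have "\<bar>\<alpha>\<bar> \<le> 1"
    using small_norm_form[of \<gamma> \<alpha>] le1 by (simp add: mult.commute)
  ultimately consider "\<gamma> = 0" | "\<alpha> = 0" "\<bar>\<gamma>\<bar> = 1" | "\<bar>\<alpha>\<bar> = 1" "\<bar>\<gamma>\<bar> = 1"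
    by linarith
  then have "a' = a \<and> b' = b"
  proof cases
    \<comment> \<open>The matrix is a translation up to sign. Both middle coefficients lie in the
      half-open interval of length \<open>2 a\<close>, so the shift is zero.\<close>
    case 1
    then have ad: "\<alpha> * \<delta> = 1" using h(1) by simp
    then have "\<alpha>^2 = 1" by (metis power2_eq_1_iff zmult_eq_1_iff)
    then have a': "a' = a" using h(2) 1 by simp
    have b': "b' = b + 2 * a * (\<alpha> * \<beta>)" using h(3) 1 ad by (simp add: algebra_simps)
    have "\<bar>2 * a * (\<alpha> * \<beta>)\<bar> < 2 * a"
      using b' P Q unfolding a' by linarith
    then have "\<alpha> * \<beta> = 0" by (rule int_small_multiple)
    then show ?thesis using a' b' by simp
  next
    case 2
    then have g: "\<gamma>^2 = 1" by (metis power2_abs one_power2)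
    \<comment> \<open>Here \<open>c = a' \<le> a \<le> c\<close>, so \<open>q\<close> lies on the
      boundary \<open>a = c\<close>, where \<open>b\<close> is nonnegative.\<close>
    have a': "a' = c" "a = c" using h(2) 2 g aa Q(3) by simp_all
    have bg: "\<beta> * \<gamma> = -1" using h(1) 2 by simp
    have b': "b' = - b + 2 * a * (\<gamma> * \<delta>)" using h(3) 2 bg a' by (simp add: algebra_simps)
    have c': "a' = c'" if "b' = - b" using disc that a' Q(1) by simp
    show ?thesis
    proof (cases "\<gamma> * \<delta> = 0")
      case True
      then show ?thesis using b' c' P Q a' by auto
    next
      case False
      then have "1 \<le> \<bar>\<gamma> * \<delta>\<bar>" by linarith
      then have "2 * a * 1 \<le> 2 * a * \<bar>\<gamma> * \<delta>\<bar>" using Q(1) by (intro mult_left_mono) auto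
      then have "2 * a \<le> \<bar>2 * a * (\<gamma> * \<delta>)\<bar>" using Q(1) by (simp add: abs_mult)
      \<comment> \<open>\<open>b + b'\<close> has absolute value at least \<open>2 a\<close>, while
        each summand has at most \<open>a\<close>.\<close>
      then have "\<bar>b\<bar> = a" "\<bar>b'\<bar> = a'" using b' P(2) Q(2) a' by linarith+
      then show ?thesis using P(4) Q(4) a' by auto
    qed
  next
    case 3
    then have g: "\<gamma>^2 = 1" "\<alpha>^2 = 1" by (metis power2_abs one_power2)+
    have "\<bar>\<alpha> * \<gamma>\<bar> = 1" using 3 by (simp add: abs_mult)
    then have "\<bar>b * (\<alpha> * \<gamma>)\<bar> = \<bar>b\<bar>" by (simp add: abs_mult)
    moreover have "a' = a + b * (\<alpha> * \<gamma>) + c" using h(2) g by (simp add: algebra_simps)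
    \<comment> \<open>From \<open>a + c - |b| \<le> a' \<le> a\<close> follows
      \<open>c \<le> |b| \<le> a \<le> c\<close>, so equality holds throughout and
      \<open>q = [a, a, a]\<close>. The discriminant and \<open>c' \<ge> a\<close> then force
      \<open>|b'| = a\<close>.\<close>
    ultimately have e: "a = c" "\<bar>b\<bar> = a" "a' = a" using aa Q P(1-3)
      by linarith+
    have "b = a" using e Q(4) by auto
    then have "b'^2 + 3 * a^2 = 4 * (a * c')"
      using disc e by (simp add: power2_eq_square)
    moreover have "a * a \<le> a * c'" using P Q e by (intro mult_left_mono) auto
    ultimately have "a^2 \<le> b'^2" by (simp add: power2_eq_square)
    then have "\<bar>a\<bar> \<le> \<bar>b'\<bar>" by (simp add: abs_le_square_iff)
    then show ?thesis using P e \<open>b = a\<close> Q(1) by auto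
  qed
  then show ?thesis
    using bqf_disc_equiv[OF eq] Q(1) by (intro bqf_eqI_disc) (auto simp: abc abc')
qed

lemma reduced_unique:
  assumes "reduced p" "reduced q" "(p, q) \<in> bqf_equiv"
  shows "p = q"
  using reduced_unique_aux[OF assms] reduced_unique_aux[OF assms(2,1) bqf_equiv_sym[OF assms(3)]]
  by (metis linear)

section \<open>The class number as a weighted count of reduced forms\<close>

definition reduced_bqfs :: "int \<Rightarrow> bqf set" where
  "reduced_bqfs D = {q. bqf_disc q = D \<and> reduced q}"

definition reduced_weight :: "bqf \<Rightarrow> rat" where
  "reduced_weight q =
    (if coeff_a q = coeff_c q \<and> coeff_b q = coeff_a q then 1/3
     else if coeff_a q = coeff_c q \<and> coeff_b q = 0 then 1/2 else 1)"

text \<open>The exceptional forms \<open>[a, a, a]\<close> and \<open>[a, 0, a]\<close> are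
  themselves reduced, so by uniqueness a reduced form lies in such a class only if it equals that
  form.\<close>

lemma class_weight_reduced:
  assumes "reduced q"
  shows "class_weight (bqf_equiv `` {q}) = reduced_weight q"
proof -
  have eq: "bqf_equiv `` {q} = bqf_equiv `` {r} \<longleftrightarrow> q = r" if "reduced r" for r
    using reduced_unique[OF assms that] equiv_bqf_equiv
    by (metis UNIV_I eq_equiv_class)
  have "(\<exists>a\<ge>1. bqf_equiv `` {q} = bqf_equiv `` {BQF a a a}) \<longleftrightarrow> (\<exists>a\<ge>1. q = BQF a a a)"
    "(\<exists>a\<ge>1. bqf_equiv `` {q} = bqf_equiv `` {BQF a 0 a}) \<longleftrightarrow> (\<exists>a\<ge>1. q = BQF a 0 a)"
    by (rule ex_cong1, rule conj_cong, simp, rule eq, simp add: reduced_def)+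
  moreover have "(\<exists>a\<ge>1. q = BQF a a a) \<longleftrightarrow> coeff_a q = coeff_c q \<and> coeff_b q = coeff_a q"
    "(\<exists>a\<ge>1. q = BQF a 0 a) \<longleftrightarrow> coeff_a q = coeff_c q \<and> coeff_b q = 0"
    using assms by (cases q; auto simp: reduced_def)+
  ultimately show ?thesis
    unfolding class_weight_def reduced_weight_def by simp
qed

text \<open>Sending a reduced form to its class is a bijection: uniqueness gives injectivity,
  existence gives surjectivity.\<close>

lemma hurwitz_class_number_reduced:
  assumes "D < 0"
  shows "hurwitz_class_number \<bar>D\<bar> = (\<Sum>q\<in>reduced_bqfs D. reduced_weight q)"
proof -
  have "bij_betw (\<lambda>q. bqf_equiv `` {q}) (reduced_bqfs D) (positive_bqfs D // bqf_equiv)"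
  proof (rule bij_betwI')
    fix p q assume "p \<in> reduced_bqfs D" "q \<in> reduced_bqfs D"
    then show "bqf_equiv `` {p} = bqf_equiv `` {q} \<longleftrightarrow> p = q"
      using reduced_unique equiv_bqf_equiv
      by (metis (no_types, lifting) UNIV_I eq_equiv_class mem_Collect_eq reduced_bqfs_def)
  next
    fix q assume "q \<in> reduced_bqfs D"
    then have "q \<in> positive_bqfs D"
      by (auto simp: reduced_bqfs_def positive_bqfs_def reduced_def)
    then show "bqf_equiv `` {q} \<in> positive_bqfs D // bqf_equiv" by (rule quotientI)
  next
    fix C assume "C \<in> positive_bqfs D // bqf_equiv"
    then obtain q where q: "q \<in> positive_bqfs D" "C = bqf_equiv `` {q}"
      by (rule quotientE)
    then obtain r where r: "(r, q) \<in> bqf_equiv" "reduced r"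
      using ex_reduced[of q] assms by (auto simp: positive_bqfs_def)
    have "r \<in> reduced_bqfs D"
      using bqf_disc_equiv[OF r(1)] q r by (auto simp: reduced_bqfs_def positive_bqfs_def)
    moreover have "C = bqf_equiv `` {r}"
      unfolding q(2) using equiv_class_eq[OF equiv_bqf_equiv r(1)] by simp
    ultimately show "\<exists>x\<in>reduced_bqfs D. C = bqf_equiv `` {x}" by blast
  qed
  from sum.reindex_bij_betw[OF this, of class_weight]
  have "hurwitz_class_number \<bar>D\<bar> = (\<Sum>q\<in>reduced_bqfs D. class_weight (bqf_equiv `` {q}))"
    using assms by (simp add: hurwitz_class_number_def)
  also have "\<dots> = (\<Sum>q\<in>reduced_bqfs D. reduced_weight q)"
    by (intro sum.cong refl class_weight_reduced) (simp add: reduced_bqfs_def)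
  finally show ?thesis .
qed

text \<open>Since \<open>b^2 \<le> a c\<close>, the number \<open>4 a c - b^2\<close> is at least
  \<open>3 a c\<close>, which bounds \<open>c\<close> and with it \<open>a\<close> and
  \<open>|b|\<close>.\<close>

lemma finite_reduced_bqfs: "finite (reduced_bqfs D)"
proof (rule finite_subset)
  show "reduced_bqfs D \<subseteq> (\<lambda>(a, b, c). BQF a b c) ` ({- \<bar>D\<bar>..\<bar>D\<bar>} \<times> {- \<bar>D\<bar>..\<bar>D\<bar>} \<times> {- \<bar>D\<bar>..\<bar>D\<bar>})"
  proof
    fix q assume q: "q \<in> reduced_bqfs D"
    obtain a b c where abc: "q = BQF a b c" by (cases q)
    have h: "0 < a" "\<bar>b\<bar> \<le> a" "a \<le> c" "b^2 - 4 * (a * c) = D"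
      using q by (auto simp: reduced_bqfs_def reduced_def bqf_disc_def abc)
    have "\<bar>b\<bar> * \<bar>b\<bar> \<le> a * c" using h by (intro mult_mono) auto
    then have "b^2 \<le> a * c" by (simp add: power2_eq_square)
    moreover have "1 * c \<le> a * c" using h by (intro mult_right_mono) auto
    ultimately have "c \<le> \<bar>D\<bar>" using h(1,3,4) by linarith
    then show "q \<in> (\<lambda>(a, b, c). BQF a b c) ` ({- \<bar>D\<bar>..\<bar>D\<bar>} \<times> {- \<bar>D\<bar>..\<bar>D\<bar>} \<times> {- \<bar>D\<bar>..\<bar>D\<bar>})"
      using h by (intro image_eqI[of _ _ "(a, b, c)"]) (auto simp: abc)
  qed
qed simp

section \<open>Selling parameters of reduced forms\<close>

text \<open>Solves \<open>t [a, b, c] = [f + g, 2 g, e + g]\<close> for \<open>(e, f, g)\<close>;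
  \<open>selling_form\<close> is the inverse.\<close>

definition selling :: "int \<Rightarrow> bqf \<Rightarrow> int \<times> int \<times> int" where
  "selling t q = (let g = t * coeff_b q div 2 in (t * coeff_c q - g, t * coeff_a q - g, g))"

definition selling_form :: "int \<Rightarrow> int \<times> int \<times> int \<Rightarrow> bqf" where
  "selling_form t = (\<lambda>(e, f, g). BQF ((f + g) div t) (2 * g div t) ((e + g) div t))"

text \<open>The inequalities mirror \<open>a \<le> c\<close>, \<open>b \<le> a\<close>,
  \<open>0 \<le> b\<close> and \<open>0 < a\<close> in this order; only \<open>g\<close> may
  vanish.\<close>

definition selling_triples :: "int \<Rightarrow> int \<Rightarrow> (int \<times> int \<times> int) set" where
  "selling_triples t n = {(e, f, g). e \<ge> f \<and> f \<ge> g \<and> g \<ge> 0 \<and> f > 0 \<and>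
     e * f + e * g + f * g = n \<and> (t = 2 \<longrightarrow> odd e \<and> odd f \<and> odd g)}"

text \<open>The scale \<open>t\<close> is 2 for odd and 1 for even \<open>D\<close>, which is where \<open>n = t^2 * \<bar>D\<bar> / 4\<close>
  comes from.\<close>

lemma bij_betw_selling:
  assumes "t = (if odd D then 2 else 1)" "4 * n = - (t^2 * D)"
  shows "bij_betw (selling t) {q \<in> reduced_bqfs D. 0 \<le> coeff_b q} (selling_triples t n)"
proof (rule bij_betw_byWitness[where f' = "selling_form t"])
  have par: "t * coeff_b q = 2 * (t * coeff_b q div 2)" "odd D \<Longrightarrow> odd (t * coeff_b q div 2)"
    if "q \<in> reduced_bqfs D" for q
  proof -
    \<comment> \<open>\<open>D\<close> and \<open>b^2\<close> agree modulo 4, so the scale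
      \<open>t\<close> always makes \<open>t b\<close> even and the halving exact.\<close>
    have "odd (coeff_b q) \<longleftrightarrow> odd D"
      using that by (auto simp: reduced_bqfs_def bqf_disc_def)
    then show "t * coeff_b q = 2 * (t * coeff_b q div 2)" "odd D \<Longrightarrow> odd (t * coeff_b q div 2)"
      using assms(1) by auto
  qed
  have t: "t > 0" using assms(1) by simp
  show "\<forall>q\<in>{q \<in> reduced_bqfs D. 0 \<le> coeff_b q}. selling_form t (selling t q) = q"
    using par(1) t
    by (auto simp: selling_form_def selling_def Let_def simp flip: par(1) intro!: bqf.expand)
  have tdiv: "t * (x div t) = x" if "odd D \<Longrightarrow> even x" for x
    using assms(1) that by auto
  have tri: "odd D \<longrightarrow> odd e \<and> odd f \<and> odd g" "0 \<le> g" "g \<le> f" "f \<le> e" "0 < f"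
      "e * f + e * g + f * g = n" if "(e, f, g) \<in> selling_triples t n" for e f g
    using that assms(1) by (auto simp: selling_triples_def)
  have td: "t * ((f + g) div t) = f + g" "t * (2 * g div t) = 2 * g"
      "t * ((e + g) div t) = e + g" if "(e, f, g) \<in> selling_triples t n" for e f g
    using tri(1)[OF that] by (intro tdiv; simp)+
  show "\<forall>x\<in>selling_triples t n. selling t (selling_form t x) = x"
    by (auto simp: selling_form_def selling_def Let_def td)
  show "selling t ` {q \<in> reduced_bqfs D. 0 \<le> coeff_b q} \<subseteq> selling_triples t n"
  proof (intro image_subsetI)
    fix q assume "q \<in> {q \<in> reduced_bqfs D. 0 \<le> coeff_b q}"
    then have q: "q \<in> reduced_bqfs D" "0 \<le> coeff_b q" by auto
    obtain a b c where abc: "q = BQF a b c" by (cases q)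
    define g where "g = t * b div 2"
    have g: "t * b = 2 * g" "odd D \<Longrightarrow> odd g"
      using par[OF q(1)] by (simp_all add: abc g_def)
    have h: "0 < a" "0 \<le> b" "b \<le> a" "a \<le> c" "b^2 - 4 * a * c = D"
      using q by (auto simp: reduced_bqfs_def reduced_def bqf_disc_def abc)
    have m: "t * b \<le> t * a" "t * a \<le> t * c" "0 \<le> t * b" "0 < t * a"
      using h t by auto
    have "4 * ((t * c - g) * (t * a - g) + (t * c - g) * g + (t * a - g) * g)
        = 4 * t^2 * a * c - (2 * g)^2" by algebra
    also have "\<dots> = - (t^2 * D)" unfolding g(1)[symmetric] h(5)[symmetric] by algebra
    finally have "(t * c - g) * (t * a - g) + (t * c - g) * g + (t * a - g) * g = n"
      using assms(2) by simp
    \<comment> \<open>For \<open>t = 2\<close> the other parameters \<open>2 c - g\<close> and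
      \<open>2 a - g\<close> have the parity of \<open>g\<close>.\<close>
    moreover have "t = 2 \<longrightarrow> odd g" using g assms(1) by (auto split: if_splits)
    ultimately show "selling t q \<in> selling_triples t n"
      using m g(1) by (auto simp: selling_def selling_triples_def abc Let_def simp flip: g_def)
  qed
  show "selling_form t ` selling_triples t n \<subseteq> {q \<in> reduced_bqfs D. 0 \<le> coeff_b q}"
  proof (intro image_subsetI)
    fix x assume x: "x \<in> selling_triples t n"
    obtain e f g where efg: "x = (e, f, g)" by (cases x)
    define a b c where "a = (f + g) div t" and "b = 2 * g div t" and "c = (e + g) div t"
    have abc: "t * a = f + g" "t * b = 2 * g" "t * c = e + g"
      using td[OF x[unfolded efg]] by (simp_all add: a_def b_def c_def)
    note T = tri[OF x[unfolded efg]]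
    have "t * 0 < t * a" "t * 0 \<le> t * b" "t * b \<le> t * a" "t * a \<le> t * c"
      unfolding abc using T by auto
    then have "0 < a" "0 \<le> b" "b \<le> a" "a \<le> c"
      using t by (simp_all only: mult_less_cancel_left_pos mult_le_cancel_left_pos)
    moreover have "t^2 * (b^2 - 4 * a * c) = (t * b)^2 - 4 * (t * a) * (t * c)" by algebra
    then have "t^2 * (b^2 - 4 * a * c) = t^2 * D"
      unfolding abc using assms(2) T(6) by (simp add: power2_eq_square algebra_simps)
    then have "b^2 - 4 * a * c = D" using t by simp
    ultimately show "selling_form t x \<in> {q \<in> reduced_bqfs D. 0 \<le> coeff_b q}"
      by (simp add: selling_form_def efg reduced_bqfs_def reduced_def bqf_disc_def
          flip: a_def b_def c_def)
  qed
qed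

text \<open>Weight 2 counts a reduced form together with its opposite; \<open>e = f = g\<close>
  belongs to \<open>[a, a, a]\<close>, and \<open>e = f\<close>, \<open>g = 0\<close> to
  \<open>[a, 0, a]\<close>.\<close>

definition triple_weight :: "int \<times> int \<times> int \<Rightarrow> rat" where
  "triple_weight = (\<lambda>(e, f, g).
     if e > f \<and> f > g \<and> g > 0 then 2
     else if e = f \<and> f = g then 1/3 else if e = f \<and> g = 0 then 1/2 else 1)"

text \<open>The reduced forms with \<open>b < 0\<close> are exactly the opposites of those with
  \<open>0 < b < a < c\<close>, that is, with \<open>e > f > g > 0\<close>.\<close>

lemma hurwitz_class_number_selling:
  assumes "D < 0" "t = (if odd D then 2 else 1)" "4 * n = - (t^2 * D)"
  shows "hurwitz_class_number \<bar>D\<bar> = (\<Sum>x\<in>selling_triples t n. triple_weight x)"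
    and "finite (selling_triples t n)"
proof -
  define R where "R = {q \<in> reduced_bqfs D. 0 \<le> coeff_b q}"
  define A where "A = {q \<in> reduced_bqfs D. 0 < coeff_b q \<and> coeff_b q < coeff_a q \<and> coeff_a q < coeff_c q}"
  define opp where "opp q = BQF (coeff_a q) (- coeff_b q) (coeff_c q)" for q
  have fin: "finite R" "finite A"
    using finite_reduced_bqfs[of D] by (simp_all add: R_def A_def)
  have "inj_on opp A"
    by (rule inj_onI) (auto simp: opp_def intro: bqf.expand)
  have "reduced_bqfs D = R \<union> opp ` A"
  proof (intro equalityI subsetI)
    fix q assume q: "q \<in> reduced_bqfs D"
    show "q \<in> R \<union> opp ` A"
    proof (cases "0 \<le> coeff_b q")
      case False
      then have "opp q \<in> A" using q
        by (auto simp: A_def opp_def reduced_bqfs_def reduced_def bqf_disc_def)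
      then have "opp (opp q) \<in> opp ` A" by (rule imageI)
      then show ?thesis by (simp add: opp_def)
    qed (use q in \<open>simp add: R_def\<close>)
  qed (auto simp: R_def A_def opp_def reduced_bqfs_def reduced_def bqf_disc_def)
  moreover have "R \<inter> opp ` A = {}" by (auto simp: R_def A_def opp_def)
  ultimately have "(\<Sum>q\<in>reduced_bqfs D. reduced_weight q)
      = (\<Sum>q\<in>R. reduced_weight q) + (\<Sum>q\<in>opp ` A. reduced_weight q)"
    using fin by (simp add: sum.union_disjoint)
  \<comment> \<open>The strict inequality \<open>a < c\<close> rules out both exceptional
    weights.\<close>
  also have "(\<Sum>q\<in>opp ` A. reduced_weight q) = (\<Sum>q\<in>A. 1)"
    unfolding sum.reindex[OF \<open>inj_on opp A\<close>]
    by (intro sum.cong refl) (auto simp: A_def opp_def reduced_weight_def)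
  also have "\<dots> = (\<Sum>q\<in>R. if q \<in> A then 1 else 0)"
    using fin by (simp add: sum.If_cases) (auto simp: R_def A_def intro!: arg_cong[where f = card])
  also have "(\<Sum>q\<in>R. reduced_weight q) + \<dots> = (\<Sum>q\<in>R. triple_weight (selling t q))"
    unfolding sum.distrib[symmetric]
  proof (intro sum.cong refl)
    fix q assume "q \<in> R"
    then have q: "q \<in> reduced_bqfs D" "0 \<le> coeff_b q" by (auto simp: R_def)
    obtain a b c where abc: "q = BQF a b c" by (cases q)
    have h: "0 < a" "0 \<le> b" "b \<le> a" "a \<le> c"
      using q by (auto simp: reduced_bqfs_def reduced_def abc)
    have "odd b \<longleftrightarrow> odd D"
      using q by (auto simp: reduced_bqfs_def bqf_disc_def abc)
    then have "(t = 2 \<and> t * b div 2 = b) \<or> (t = 1 \<and> (\<exists>k. b = 2 * k \<and> t * b div 2 = k))"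
      using assms(2) by auto
    then show "reduced_weight q + (if q \<in> A then 1 else 0) = triple_weight (selling t q)"
      using h q(1)
      by (auto simp: reduced_weight_def A_def triple_weight_def selling_def Let_def abc)
  qed
  also have "\<dots> = (\<Sum>x\<in>selling_triples t n. triple_weight x)"
    using sum.reindex_bij_betw[OF bij_betw_selling[OF assms(2,3)]] by (simp add: R_def)
  finally show "hurwitz_class_number \<bar>D\<bar> = (\<Sum>x\<in>selling_triples t n. triple_weight x)"
    using hurwitz_class_number_reduced[OF assms(1)] by simp
  show "finite (selling_triples t n)"
    using bij_betw_finite[OF bij_betw_selling[OF assms(2,3)]] fin(1) by (simp add: R_def)
qed

section \<open>Sorting the triples into the four sums\<close>

theorem theorem5p2:
  fixes D n :: int
  assumes "D mod 4 = 0 \<or> D mod 4 = 1"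
    and "D < 0"
    and "n = (if odd D then \<bar>D\<bar> else \<bar>D\<bar> div 4)"
  shows "hurwitz_class_number \<bar>D\<bar> =
      2 * (\<Sum>(e, f, g) \<in> {(e::int, f::int, g::int).
              e > f \<and> f > g \<and> g > 0 \<and> e * f + e * g + f * g = n
              \<and> (odd D \<longrightarrow> odd e \<and> odd f \<and> odd g)}. 1)
      + (\<Sum>(e, f) \<in> {(e::int, f::int).
              e > 0 \<and> f > 0 \<and> e \<noteq> f \<and> e^2 + 2 * e * f = n
              \<and> (odd D \<longrightarrow> odd e \<and> odd f)}. 1)
      + 1/3 * (\<Sum>e \<in> {e::int. e > 0 \<and> 3 * e^2 = n}. 1)
      + (if even D then
           1/2 * (\<Sum>(e, f) \<in> {(e::int, f::int). e > 0 \<and> f > 0 \<and> e * f = n}. 1)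
         else 0)"
proof -
  define t :: int where "t = (if odd D then 2 else 1)"
  define T where "T = selling_triples t n"
  have odd_iff: "t = 2 \<longleftrightarrow> odd D" by (simp add: t_def)
  \<comment> \<open>Makes the division by 4 in \<open>n\<close> exact.\<close>
  have "4 dvd D" if "even D" using assms(1) that by presburger
  then have "4 * n = - (t^2 * D)"
    using assms(2,3) by (auto simp: t_def)
  note H = hurwitz_class_number_selling[OF assms(2) t_def this, folded T_def]
  have T: "(e, f, g) \<in> T \<longleftrightarrow> e \<ge> f \<and> f \<ge> g \<and> g \<ge> 0 \<and> f > 0 \<and> e * f + e * g + f * g = n
      \<and> (odd D \<longrightarrow> odd e \<and> odd f \<and> odd g)" for e f g
    by (auto simp: T_def selling_triples_def odd_iff)
  define A where "A = {(e, f, g) \<in> T. e > f \<and> f > g \<and> g > 0}"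
  \<comment> \<open>Exactly two of the three positive entries coincide.\<close>
  define B where "B = {(e, f, g) \<in> T. g > 0 \<and> (e = f) \<noteq> (f = g)}"
  define C where "C = {(e, f, g) \<in> T. e = f \<and> f = g}"
  define E where "E = {(e, f, g) \<in> T. g = 0}"
  \<comment> \<open>Triples with \<open>g = 0\<close> weigh 1 if \<open>e > f\<close> and 1/2 if
    \<open>e = f\<close>. Half the indicator of \<open>E\<close> plus half that of \<open>E'\<close>
    gives both values, and \<open>E'\<close> will supply the reversed ordered pairs.\<close>
  define E' where "E' = {(e, f, g) \<in> T. g = 0 \<and> e > f}"
  have sub: "A \<subseteq> T" "B \<subseteq> T" "C \<subseteq> T" "E \<subseteq> T" "E' \<subseteq> T"
    by (auto simp: A_def B_def C_def E_def E'_def)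
  have ind: "(\<Sum>x\<in>T. of_bool (x \<in> X)) = (of_nat (card X) :: rat)" if "X \<subseteq> T" for X
    using H(2) that by (simp add: Int_absorb1)
  have "hurwitz_class_number \<bar>D\<bar> = (\<Sum>x\<in>T. 2 * of_bool (x \<in> A) + of_bool (x \<in> B)
      + 1/3 * of_bool (x \<in> C) + 1/2 * (of_bool (x \<in> E) + of_bool (x \<in> E')))"
    unfolding H(1)
  proof (intro sum.cong refl)
    fix x assume "x \<in> T"
    obtain e f g where x: "x = (e, f, g)" by (cases x)
    have "e \<ge> f" "f \<ge> g" "g \<ge> 0" "f > 0"
      using \<open>x \<in> T\<close> unfolding x T by simp_all
    then show "triple_weight x = 2 * of_bool (x \<in> A) + of_bool (x \<in> B)
      + 1/3 * of_bool (x \<in> C) + 1/2 * (of_bool (x \<in> E) + of_bool (x \<in> E'))"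
      using \<open>x \<in> T\<close> unfolding x
      by (simp add: A_def B_def C_def E_def E'_def triple_weight_def)
  qed
  also have "\<dots> = 2 * of_nat (card A) + of_nat (card B) + 1/3 * of_nat (card C)
      + 1/2 * (of_nat (card E) + of_nat (card E'))"
    unfolding sum.distrib sum_distrib_left[symmetric] ind[OF sub(1)] ind[OF sub(2)]
      ind[OF sub(3)] ind[OF sub(4)] ind[OF sub(5)] ..
  also have "A = {(e, f, g). e > f \<and> f > g \<and> g > 0 \<and> e * f + e * g + f * g = n
      \<and> (odd D \<longrightarrow> odd e \<and> odd f \<and> odd g)}"
    by (auto simp: A_def T)
  also have "card B = card {(e, f). e > 0 \<and> f > 0 \<and> e \<noteq> f \<and> e^2 + 2 * e * f = n
      \<and> (odd D \<longrightarrow> odd e \<and> odd f)}"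
  \<comment> \<open>The pair consists of the repeated entry, then the remaining one; the inverse
    sorts them back into a decreasing triple.\<close>
  proof (intro bij_betw_same_card[of "\<lambda>(e, f, g). if e = f then (e, g) else (f, e)"]
        bij_betw_byWitness[where f' = "\<lambda>(e, f). if e > f then (e, e, f) else (f, e, e)"])
    show "(\<lambda>(e, f, g). if e = f then (e, g) else (f, e)) ` B \<subseteq> 
        {(e, f). e > 0 \<and> f > 0 \<and> e \<noteq> f \<and> e^2 + 2 * e * f = n \<and> (odd D \<longrightarrow> odd e \<and> odd f)}"
      by (auto simp: B_def T power2_eq_square)
    show "(\<lambda>(e, f). if e > f then (e, e, f) else (f, e, e)) ` 
        {(e, f). e > 0 \<and> f > 0 \<and> e \<noteq> f \<and> e^2 + 2 * e * f = n \<and> (odd D \<longrightarrow> odd e \<and> odd f)} \<subseteq> B"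
      by (auto simp: B_def T power2_eq_square split: if_splits)
  qed (auto simp: B_def T)
  also have "card C = card {e. e > 0 \<and> 3 * e^2 = n}"
  proof (intro bij_betw_same_card[of "\<lambda>(e, f, g). e"]
      bij_betw_byWitness[where f' = "\<lambda>e. (e, e, e)"])
    \<comment> \<open>The parity demanded of the triple \<open>(e, e, e)\<close> comes from
      \<open>n\<close> being odd.\<close>
    have "odd e" if "odd D" "3 * e^2 = n" for e
    proof -
      have "odd (3 * e^2)" using that(1) unfolding that(2) assms(3) by simp
      then show ?thesis by simp
    qed
    then show "(\<lambda>e. (e, e, e)) ` {e. e > 0 \<and> 3 * e^2 = n} \<subseteq> C"
      by (auto simp: C_def T power2_eq_square)
  qed (auto simp: C_def T power2_eq_square)
  also have "1/2 * (of_nat (card E) + of_nat (card E')) =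
      (if even D then 1/2 * of_nat (card {(e, f). e > 0 \<and> f > 0 \<and> e * f = n}) else (0::rat))"
  proof (cases "even D")
    case True
    \<comment> \<open>Ordered factorizations of \<open>n\<close>: \<open>?F\<close> has those with
      first factor at least the second, \<open>?G\<close> the others.\<close>
    let ?F = "(\<lambda>(e, f, g). (e, f)) ` E" and ?G = "(\<lambda>(e, f, g). (f, e)) ` E'"
    have fin: "finite E" "finite E'"
      using sub H(2) finite_subset by blast+
    have "{(e, f). e > 0 \<and> f > 0 \<and> e * f = n} = ?F \<union> ?G"
    proof (intro equalityI subsetI)
      fix x assume "x \<in> {(e, f). e > 0 \<and> f > 0 \<and> e * f = n}"
      then obtain e f where x: "x = (e, f)" "e > 0" "f > 0" "e * f = n" by auto
      show "x \<in> ?F \<union> ?G"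
      proof (cases "f \<le> e")
        case True
        then have "(e, f, 0) \<in> E" using x \<open>even D\<close> by (auto simp: E_def T)
        then show ?thesis using x(1) by force
      next
        case False
        then have "(f, e, 0) \<in> E'" using x \<open>even D\<close> by (auto simp: E'_def T mult.commute)
        then show ?thesis using x(1) by force
      qed
    qed (auto simp: E_def E'_def T mult.commute)
    moreover have "?F \<inter> ?G = {}" by (auto simp: E_def E'_def T)
    moreover have "card ?F = card E" "card ?G = card E'"
      by (auto intro!: card_image inj_onI simp: E_def E'_def)
    ultimately show ?thesis
      using True fin by (simp add: card_Un_disjoint)
  next
    case False
    \<comment> \<open>For odd \<open>D\<close> the entry \<open>g\<close> must be odd, so it cannot
      be 0.\<close>
    then have "E = {}" "E' = {}" by (auto simp: E_def E'_def T)
    then show ?thesis using False by simp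
  qed
  finally show ?thesis by (simp add: case_prod_unfold)
qed

end
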